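(* For colour stretch $1+\varepsilon$ it is impossible to achieve bin stretch better than $1.69103$ for sufficiently small $\varepsilon$: for every $\alpha<1.69103$ there is $\varepsilon_0>0$ such that for every $0<\varepsilon\le\varepsilon_0$ it is not the case that every instance of the coloured bin packing problem admits an $(\alpha,1+\varepsilon)$-approximate packing.
   Context: Coloured bin packing: an instance $I$ is a finite set of items, each item $e$ having a size $s(e)\in(0,1]$ and a colour $c(e)\in C=\{1,\dots,m\}$; items are to be packed into unit-capacity bins (the total size of items in a bin is at most $1$). $I_c$ denotes the set of items of colour $c$. $\mathrm{OPT}(I)$ (resp. $\mathrm{OPT}(I_c)$) is the minimum number of bins needed to pack $I$ (resp. $I_c$). For a packing $P$ of $I$, $P(I)$ is the number of bins used and $P_c(I)$ is the number of bins containing at least one item of colour $c$. A packing is $(\alpha,\beta)$-approximate if $P(I)\le \alpha\,\mathrm{OPT}(I)+O(1)$ and $P_c(I)\le \beta\,\mathrm{OPT}(I_c)+O(1)$ for every colour $c$, where the additive constants are independent of the instance. *)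

theory Defs
  imports Complex_Main "HOL-Library.Disjoint_Sets"
begin

record 'e cbp_instance =
  items :: "'e set"
  item_size :: "'e \<Rightarrow> real"
  colour :: "'e \<Rightarrow> nat"
  num_colours :: nat

definition valid_instance :: "'e cbp_instance \<Rightarrow> bool" where
  "valid_instance I \<longleftrightarrow>
     finite (items I) \<and>
     (\<forall>e\<in>items I. 0 < item_size I e \<and> item_size I e \<le> 1 \<and> colour I e \<in> {1..num_colours I})"

definition colour_class :: "'e cbp_instance \<Rightarrow> nat \<Rightarrow> 'e set" where
  "colour_class I c = {e \<in> items I. colour I e = c}"

text \<open>
  A packing is the set of its non-empty bins, a bin being the set of items it contains.
  The cardinality of a packing is therefore the number of bins used.
\<close>

definition packing :: "('e \<Rightarrow> real) \<Rightarrow> 'e set \<Rightarrow> 'e set set \<Rightarrow> bool" where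
  "packing s X P \<longleftrightarrow> partition_on X P \<and> (\<forall>B\<in>P. sum s B \<le> 1)"

definition opt_bins :: "('e \<Rightarrow> real) \<Rightarrow> 'e set \<Rightarrow> nat" where
  "opt_bins s X = (LEAST n. \<exists>P. packing s X P \<and> card P = n)"

definition colour_bins :: "'e cbp_instance \<Rightarrow> nat \<Rightarrow> 'e set set \<Rightarrow> nat" where
  "colour_bins I c P = card {B \<in> P. \<exists>e\<in>B. colour I e = c}"

text \<open>
  The additive constants \<open>K\<close> (bins) and \<open>L\<close> (bins per colour) are explicit parameters,
  so that they can be quantified outside the instance.
\<close>

definition approx_packing ::
    "real \<Rightarrow> real \<Rightarrow> real \<Rightarrow> real \<Rightarrow> 'e cbp_instance \<Rightarrow> 'e set set \<Rightarrow> bool" where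
  "approx_packing \<alpha> \<beta> K L I P \<longleftrightarrow>
     packing (item_size I) (items I) P \<and>
     real (card P) \<le> \<alpha> * real (opt_bins (item_size I) (items I)) + K \<and>
     (\<forall>c\<in>{1..num_colours I}.
        real (colour_bins I c P) \<le> \<beta> * real (opt_bins (item_size I) (colour_class I c)) + L)"

end

theory Submission imports Defs begin

text \<open>
  Colour \<open>i\<close> consists of \<open>n\<close> items of size slightly above \<open>1 / (d i + 1)\<close>, where
  \<open>d i + 1\<close> runs through the Sylvester numbers 2, 3, 7, 43, 1807, 3263443. One item of each
  colour fits into a bin, so \<open>n\<close> bins suffice for the whole instance, whereas colour \<open>i\<close> alone
  needs \<open>n / d i\<close> bins, each holding \<open>d i\<close> items. If the colour stretch is \<open>1 + \<epsilon>\<close>, nearly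
  \<open>n / d i\<close> bins contain \<open>d i\<close> items of colour \<open>i\<close>. Such a bin is more than half full with
  colour \<open>i\<close>, so these bins are different for different colours, and their total number is about
  \<open>(\<Sum>i. 1 / d i) * n > 1.69103 * n\<close>. Six colours are really needed: the first five reciprocals
  sum up to 1.6910299.
\<close>

section \<open>General facts on packings\<close>

text \<open>The non-empty fibres of \<open>f\<close> are the bins, so an upper bound on
  \<open>opt_bins\<close> only needs a labelling of the items.\<close>

lemma opt_bins_le_card_image:
  assumes "finite X" and fibre: "\<And>b. b \<in> f ` X \<Longrightarrow> sum s {x \<in> X. f x = b} \<le> 1"
  shows "opt_bins s X \<le> card (f ` X)"
proof -
  define P where "P = (\<lambda>b. {x \<in> X. f x = b}) ` f ` X"
  have "partition_on X P"
    by (rule partition_onI) (auto simp: P_def disjnt_def)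
  then have "packing s X P"
    using fibre by (auto simp: packing_def P_def)
  then have "opt_bins s X \<le> card P"
    unfolding opt_bins_def by (intro Least_le) blast
  also have "card P \<le> card (f ` X)"
    unfolding P_def using \<open>finite X\<close> by (intro card_image_le) simp
  finally show ?thesis .
qed

lemma packing_finite_bins: "packing s X P \<Longrightarrow> finite X \<Longrightarrow> finite P"
  by (auto simp: packing_def intro: finite_elements)

text \<open>Lets a possibly negative stretch be replaced by \<open>max \<alpha> 0\<close>.\<close>

lemma approx_packing_mono:
  "approx_packing \<alpha> \<beta> K L I P \<Longrightarrow> \<alpha> \<le> \<alpha>' \<Longrightarrow> approx_packing \<alpha>' \<beta> K L I P"
  unfolding approx_packing_def
  by (meson add_right_mono mult_right_mono of_nat_0_le_iff order_trans)

section \<open>The instance with \<open>m\<close> layers and upper bounds on its optima\<close>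

text \<open>By \<open>s_gt\<close> and \<open>s_le\<close> exactly \<open>d c\<close> items of
  colour \<open>c\<close> fit into a bin; by \<open>s_sum\<close> one item of each colour fits.
  Divisibility makes \<open>n / d c\<close> a whole number of bins.\<close>

locale layered =
  fixes m n :: nat and d :: "nat \<Rightarrow> nat" and s :: "nat \<Rightarrow> real"
  assumes m_pos: "0 < m"
    and d_pos: "\<And>c. c \<in> {1..m} \<Longrightarrow> 0 < d c"
    and d_dvd: "\<And>c. c \<in> {1..m} \<Longrightarrow> d c dvd n"
    and s_gt: "\<And>c. c \<in> {1..m} \<Longrightarrow> 1 / (real (d c) + 1) < s c"
    and s_le: "\<And>c. c \<in> {1..m} \<Longrightarrow> s c \<le> 1 / real (d c)"
    and s_sum: "(\<Sum>c = 1..m. s c) \<le> 1"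
begin

text \<open>The number \<open>e\<close> encodes a pair: \<open>e mod m\<close> gives the colour,
  shifted because colours start at 1, and \<open>e div m\<close> is the index of the item within its
  colour.\<close>

definition kind :: "nat \<Rightarrow> nat" where
  "kind e = Suc (e mod m)"

definition inst :: "nat cbp_instance" where
  "inst = \<lparr>items = {..<n * m}, item_size = s \<circ> kind, colour = kind, num_colours = m\<rparr>"

lemma inst_simps [simp]:
  "items inst = {..<n * m}" "item_size inst e = s (kind e)" "colour inst = kind"
  "num_colours inst = m"
  by (simp_all add: inst_def)

lemma kind_in: "kind e \<in> {1..m}"
  using m_pos by (simp add: kind_def Suc_leI)

lemma s_pos: "c \<in> {1..m} \<Longrightarrow> 0 < s c"
  using s_gt[of c] by (smt (verit) divide_nonneg_nonneg of_nat_0_le_iff)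

lemma valid_inst: "valid_instance inst"
proof -
  have "s c \<le> 1" if "c \<in> {1..m}" for c
  proof -
    have "s c \<le> 1 / real (d c)" using s_le that .
    also have "\<dots> \<le> 1" using d_pos[OF that] by (simp add: field_simps)
    finally show ?thesis .
  qed
  then show ?thesis
    using kind_in s_pos by (simp add: valid_instance_def del: atLeastAtMost_iff)
qed

lemma item_eqI: "kind e = kind e' \<Longrightarrow> e div m = e' div m \<Longrightarrow> e = e'"
  by (metis Suc_inject div_mult_mod_eq kind_def)

lemma card_colour_class:
  assumes "c \<in> {1..m}"
  shows "card (colour_class inst c) = n"
proof -
  have "bij_betw (\<lambda>k. k * m + (c - 1)) {..<n} (colour_class inst c)"
  proof (rule bij_betwI[where g = "\<lambda>e. e div m"])
    show "(\<lambda>k. k * m + (c - 1)) \<in> {..<n} \<rightarrow> colour_class inst c"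
    proof
      fix k assume "k \<in> {..<n}"
      then have "Suc k * m \<le> n * m" by (intro mult_le_mono1) simp
      moreover obtain b where "c = Suc b" "b < m" using assms by (cases c) auto
      ultimately show "k * m + (c - 1) \<in> colour_class inst c"
        by (simp add: colour_class_def kind_def)
    qed
    show "(\<lambda>e. e div m) \<in> colour_class inst c \<rightarrow> {..<n}"
      using m_pos by (auto simp: colour_class_def less_mult_imp_div_less)
    show "(k * m + (c - 1)) div m = k" for k
      using assms by (cases c) auto
    show "e div m * m + (c - 1) = e" if "e \<in> colour_class inst c" for e
      using that by (auto simp: colour_class_def kind_def)
  qed
  then show ?thesis by (metis bij_betw_same_card card_lessThan)
qed

text \<open>Bin \<open>k\<close> receives the item of index \<open>k\<close> of every
  colour.\<close>

lemma opt_inst_le: "opt_bins (item_size inst) (items inst) \<le> n"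
proof -
  let ?f = "\<lambda>e. e div m"
  have "opt_bins (item_size inst) (items inst) \<le> card (?f ` {..<n * m})"
    unfolding inst_simps(1)
  proof (rule opt_bins_le_card_image)
    fix b
    let ?F = "{e \<in> {..<n * m}. ?f e = b}"
    have "inj_on kind ?F" by (rule inj_onI) (auto intro: item_eqI)
    then have "sum (item_size inst) ?F = sum s (kind ` ?F)"
      by (simp add: sum.reindex)
    also have "\<dots> \<le> (\<Sum>c = 1..m. s c)"
      using kind_in s_pos by (intro sum_mono2) (auto intro: less_imp_le)
    finally show "sum (item_size inst) ?F \<le> 1" using s_sum by linarith
  qed simp
  also have "\<dots> \<le> card {..<n}"
    using m_pos by (intro card_mono) (auto simp: less_mult_imp_div_less)
  finally show ?thesis by simp
qed

text \<open>The items are cut into blocks of \<open>d c\<close> consecutive indices, one block per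
  bin.\<close>

lemma opt_colour_le:
  assumes c: "c \<in> {1..m}"
  shows "opt_bins (item_size inst) (colour_class inst c) \<le> n div d c"
proof -
  let ?X = "colour_class inst c"
  let ?f = "\<lambda>e. e div m div d c"
  have "opt_bins (item_size inst) ?X \<le> card (?f ` ?X)"
  proof (rule opt_bins_le_card_image)
    fix b
    let ?F = "{e \<in> ?X. ?f e = b}"
    \<comment> \<open>Within a block the index is determined by its remainder modulo
      \<open>d c\<close>, so a block has at most \<open>d c\<close> items.\<close>
    have "inj_on (\<lambda>e. e div m mod d c) ?F"
    proof (rule inj_onI)
      fix x y assume *: "x \<in> ?F" "y \<in> ?F" "x div m mod d c = y div m mod d c"
      then have "x div m = y div m" by (metis (mono_tags, lifting) div_mult_mod_eq mem_Collect_eq)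
      with * show "x = y" by (auto simp: colour_class_def intro: item_eqI)
    qed
    then have "card ?F = card ((\<lambda>e. e div m mod d c) ` ?F)" by (simp add: card_image)
    also have "\<dots> \<le> card {..<d c}" using d_pos[OF c] by (intro card_mono) auto
    finally have "card ?F \<le> d c" by simp
    have "sum (item_size inst) ?F = card ?F * s c"
      by (simp add: colour_class_def)
    also have "\<dots> \<le> real (d c) * (1 / real (d c))"
      using \<open>card ?F \<le> d c\<close> s_le[OF c] s_pos[OF c] by (intro mult_mono) auto
    finally show "sum (item_size inst) ?F \<le> 1" using d_pos[OF c] by simp
  qed (simp add: colour_class_def)
  also have "\<dots> \<le> card {..<n div d c}"
  proof (intro card_mono image_subsetI)
    fix e assume "e \<in> ?X"
    then have "e div m < n div d c * d c"
      using d_dvd[OF c] by (simp add: colour_class_def less_mult_imp_div_less)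
    then show "?f e \<in> {..<n div d c}" by (simp add: less_mult_imp_div_less)
  qed simp
  finally show ?thesis by simp
qed

section \<open>Bins of an arbitrary packing that are full with one colour\<close>

text \<open>For a packing and a colour of the instance, \<open>card_bin_colour_le\<close> turns the
  inequality into an equality.\<close>

definition full_bins :: "nat \<Rightarrow> nat set set \<Rightarrow> nat set set" where
  "full_bins c P = {B \<in> P. d c \<le> card (B \<inter> colour_class inst c)}"

context
  fixes P assumes P: "packing (item_size inst) (items inst) P"
begin

lemma finite_P: "finite P"
  using packing_finite_bins[OF P] by simp

lemma bin_subset: "B \<in> P \<Longrightarrow> B \<subseteq> {..<n * m}"
  using P by (auto simp: packing_def partition_on_def)

text \<open>Used with one colour to bound its items in a bin, and with two colours to show that they
  cannot both fill it.\<close>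

lemma load_le:
  assumes "B \<in> P" "C \<subseteq> {1..m}"
  shows "(\<Sum>c\<in>C. card (B \<inter> colour_class inst c) * s c) \<le> 1"
proof -
  have fin: "finite B" "finite C"
    using bin_subset[OF \<open>B \<in> P\<close>] assms(2) finite_subset by blast+
  have "(\<Sum>c\<in>C. card (B \<inter> colour_class inst c) * s c)
      = (\<Sum>c\<in>C. sum (item_size inst) (B \<inter> colour_class inst c))"
    by (simp add: colour_class_def)
  also have "\<dots> = sum (item_size inst) (\<Union>c\<in>C. B \<inter> colour_class inst c)"
    using fin by (intro sum.UNION_disjoint[symmetric]) (auto simp: colour_class_def)
  also have "\<dots> \<le> sum (item_size inst) B"
    using fin s_pos[OF kind_in] by (intro sum_mono2) (auto intro: less_imp_le)
  also have "\<dots> \<le> 1" using P \<open>B \<in> P\<close> by (auto simp: packing_def)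
  finally show ?thesis .
qed

lemma card_bin_colour_le:
  assumes "B \<in> P" and c: "c \<in> {1..m}"
  shows "card (B \<inter> colour_class inst c) \<le> d c"
proof (rule ccontr)
  let ?k = "card (B \<inter> colour_class inst c)"
  assume "\<not> ?k \<le> d c"
  then have "real (d c) + 1 \<le> real ?k" by linarith
  have "1 = (real (d c) + 1) * (1 / (real (d c) + 1))" by simp
  also have "\<dots> < (real (d c) + 1) * s c"
    using s_gt[OF c] by (intro mult_strict_left_mono) auto
  also have "\<dots> \<le> ?k * s c"
    using \<open>real (d c) + 1 \<le> real ?k\<close> s_pos[OF c] by (intro mult_right_mono) auto
  finally show False using load_le[of B "{c}"] assms by simp
qed

lemma full_bins_disjoint:
  assumes c: "c \<in> {1..m}" and c': "c' \<in> {1..m}" and "c \<noteq> c'"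
  shows "full_bins c P \<inter> full_bins c' P = {}"
proof -
  have half: "1 / 2 < card (B \<inter> colour_class inst b) * s b"
    if "B \<in> full_bins b P" "b \<in> {1..m}" for B b
  proof -
    \<comment> \<open>Equality holds for \<open>d b = 1\<close>; the strict inequality comes from
      \<open>s_gt\<close>.\<close>
    have "1 / 2 \<le> real (d b) * (1 / (real (d b) + 1))"
      using d_pos[OF that(2)] by (simp add: field_simps)
    also have "\<dots> < real (d b) * s b"
      using s_gt d_pos that(2) by (intro mult_strict_left_mono) auto
    also have "\<dots> \<le> card (B \<inter> colour_class inst b) * s b"
      using that s_pos[OF that(2)] by (intro mult_right_mono) (auto simp: full_bins_def)
    finally show ?thesis .
  qed
  have False if "B \<in> full_bins c P" "B \<in> full_bins c' P" for B
    using load_le[of B "{c, c'}"] half[OF that(1) c] half[OF that(2) c'] assms that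
    by (auto simp: full_bins_def)
  then show ?thesis by blast
qed

text \<open>A bin meeting colour \<open>c\<close> holds at most \<open>d c - 1\<close> of its items,
  plus one more if it is full. Hence few bins for the colour force many full ones.\<close>

lemma card_full_bins:
  assumes c: "c \<in> {1..m}"
  shows "n \<le> (d c - 1) * colour_bins inst c P + card (full_bins c P)"
proof -
  let ?X = "colour_class inst c"
  let ?Q = "{B \<in> P. \<exists>e\<in>B. colour inst e = c}"
  have un: "\<Union>P = {..<n * m}" and disj: "disjoint P"
    using P by (auto simp: packing_def partition_on_def)
  have "n = card ?X" using card_colour_class[OF c] ..
  also have "?X = (\<Union>B\<in>?Q. B \<inter> ?X)"
    using un by (auto simp: colour_class_def)
  also have "card \<dots> = (\<Sum>B\<in>?Q. card (B \<inter> ?X))"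
    using finite_P disj
    by (intro card_UN_disjoint) (auto simp: colour_class_def dest: disjointD)
  also have "\<dots> \<le> (\<Sum>B\<in>?Q. (d c - 1) + (if B \<in> full_bins c P then 1 else 0))"
    using card_bin_colour_le[OF _ c] by (intro sum_mono) (fastforce simp: full_bins_def)
  also have "\<dots> = (d c - 1) * card ?Q + card (?Q \<inter> full_bins c P)"
    using finite_P by (simp add: sum.distrib sum.If_cases)
  also have "card (?Q \<inter> full_bins c P) \<le> card (full_bins c P)"
    using finite_P by (intro card_mono) (auto simp: full_bins_def)
  finally show ?thesis by (simp add: colour_bins_def)
qed

end

section \<open>The trade-off between colour stretch and bin stretch\<close>

text \<open>Few bins per colour give almost \<open>n / d c\<close> full bins for each
  \<open>c\<close>; these are disjoint sets of bins, so their sizes add up to at most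
  \<open>card P\<close>, which is at most \<open>\<alpha> * n + K\<close>. The right-hand side does
  not depend on \<open>n\<close>.\<close>

lemma approx_packing_bound:
  assumes approx: "approx_packing \<alpha> (1 + \<epsilon>) K L inst P" and "0 \<le> \<alpha>" "0 < \<epsilon>"
  shows "real n * ((\<Sum>c = 1..m. 1 / real (d c)) - \<alpha> - real m * \<epsilon>)
          \<le> K + \<bar>L\<bar> * (\<Sum>c = 1..m. real (d c))"
proof -
  have P: "packing (item_size inst) (items inst) P"
    and total: "real (card P) \<le> \<alpha> * opt_bins (item_size inst) (items inst) + K"
    and col: "\<And>c. c \<in> {1..m} \<Longrightarrow>
      real (colour_bins inst c P) \<le> (1 + \<epsilon>) * opt_bins (item_size inst) (colour_class inst c) + L"
    using approx by (auto simp: approx_packing_def)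
  have full: "n * (1 / real (d c)) - n * \<epsilon> - \<bar>L\<bar> * d c \<le> card (full_bins c P)"
    if c: "c \<in> {1..m}" for c
  proof -
    define q where "q = n div d c"
    have n: "real n = d c * real q"
      using d_dvd[OF c] by (simp add: q_def flip: of_nat_mult)
    have d: "1 \<le> real (d c)" using d_pos[OF c] by simp
    \<comment> \<open>The sign of \<open>L\<close> is unknown; the absolute value gives error terms
      that may be enlarged.\<close>
    have "real (colour_bins inst c P) \<le> (1 + \<epsilon>) * q + \<bar>L\<bar>"
    proof -
      have "(1 + \<epsilon>) * opt_bins (item_size inst) (colour_class inst c) \<le> (1 + \<epsilon>) * q"
        using opt_colour_le[OF c] \<open>0 < \<epsilon>\<close> by (simp add: q_def)
      then show ?thesis using col[OF c] by linarith
    qed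
    then have "(real (d c) - 1) * colour_bins inst c P \<le> (real (d c) - 1) * ((1 + \<epsilon>) * q + \<bar>L\<bar>)"
      using d by (intro mult_left_mono) auto
    moreover have "real n \<le> (real (d c) - 1) * colour_bins inst c P + card (full_bins c P)"
    proof -
      have "real n \<le> real ((d c - 1) * colour_bins inst c P + card (full_bins c P))"
        using card_full_bins[OF P c] by (rule of_nat_mono)
      then show ?thesis using d_pos[OF c] by (simp add: of_nat_diff Suc_leI)
    qed
    \<comment> \<open>Subtracted from \<open>n\<close> this leaves \<open>q\<close>, up to
      \<open>n * \<epsilon>\<close> and \<open>\<bar>L\<bar> * d c\<close>; the terms
      \<open>q * \<epsilon>\<close> and \<open>\<bar>L\<bar>\<close> only help and are
      dropped.\<close>
    moreover have "(real (d c) - 1) * ((1 + \<epsilon>) * q + \<bar>L\<bar>)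
        = real n - real q + real n * \<epsilon> - q * \<epsilon> + \<bar>L\<bar> * d c - \<bar>L\<bar>"
      by (simp add: n algebra_simps)
    moreover have "0 \<le> q * \<epsilon>" using \<open>0 < \<epsilon>\<close> by simp
    moreover have "n * (1 / real (d c)) = q" using n d by simp
    ultimately show ?thesis by linarith
  qed
  have "(\<Sum>c = 1..m. n * (1 / real (d c)) - n * \<epsilon> - \<bar>L\<bar> * d c)
      \<le> (\<Sum>c = 1..m. real (card (full_bins c P)))"
    using full by (rule sum_mono)
  also have "\<dots> = card (\<Union>c\<in>{1..m}. full_bins c P)"
    using finite_P[OF P] full_bins_disjoint[OF P]
    by (subst card_UN_disjoint) (auto simp: full_bins_def simp del: atLeastAtMost_iff)
  also have "\<dots> \<le> real (card P)"
    using finite_P[OF P] by (intro of_nat_mono card_mono) (auto simp: full_bins_def)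
  also have "\<dots> \<le> \<alpha> * n + K"
  proof -
    have "\<alpha> * opt_bins (item_size inst) (items inst) \<le> \<alpha> * n"
      using opt_inst_le \<open>0 \<le> \<alpha>\<close> by (intro mult_left_mono) auto
    then show ?thesis using total by linarith
  qed
  finally have "(\<Sum>c = 1..m. n * (1 / real (d c)) - n * \<epsilon> - \<bar>L\<bar> * d c) \<le> \<alpha> * n + K" .
  moreover have "(\<Sum>c = 1..m. n * (1 / real (d c)) - n * \<epsilon> - \<bar>L\<bar> * d c)
      = n * (\<Sum>c = 1..m. 1 / real (d c)) - m * (n * \<epsilon>) - \<bar>L\<bar> * (\<Sum>c = 1..m. real (d c))"
    unfolding sum_subtractf sum_distrib_left by simp
  ultimately show ?thesis by (simp add: algebra_simps)
qed

end

section \<open>Letting \<open>n\<close> grow, and the choice of Sylvester sizes\<close>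

theorem no_approx_packing:
  fixes d :: "nat \<Rightarrow> nat" and s :: "nat \<Rightarrow> real"
  assumes "0 \<le> \<alpha>" and \<alpha>: "\<alpha> < (\<Sum>c = 1..m. 1 / real (d c))"
    and d_pos: "\<And>c. c \<in> {1..m} \<Longrightarrow> 0 < d c"
    and s: "\<And>c. c \<in> {1..m} \<Longrightarrow> 1 / (real (d c) + 1) < s c \<and> s c \<le> 1 / real (d c)"
    and s_sum: "(\<Sum>c = 1..m. s c) \<le> 1"
  shows "\<exists>\<epsilon>\<^sub>0>0. \<forall>\<epsilon>. 0 < \<epsilon> \<and> \<epsilon> \<le> \<epsilon>\<^sub>0 \<longrightarrow>
    \<not> (\<exists>K L. \<forall>I :: nat cbp_instance. valid_instance I \<longrightarrow>
          (\<exists>P. approx_packing \<alpha> (1 + \<epsilon>) K L I P))"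
proof -
  define gap where "gap = (\<Sum>c = 1..m. 1 / real (d c)) - \<alpha>"
  have "0 < gap" using \<alpha> by (simp add: gap_def)
  \<comment> \<open>For \<open>m = 0\<close> the empty sum would make \<open>\<alpha>\<close>
    negative.\<close>
  have "0 < m" using assms(1,2) by (cases m) auto
  show ?thesis
  proof (intro exI conjI allI impI notI)
    \<comment> \<open>With this bound \<open>m * \<epsilon>\<close> uses at most half of
      \<open>gap\<close>, so the coefficient of \<open>n\<close> stays at least
      \<open>gap / 2\<close>.\<close>
    show "0 < gap / (2 * m)" using \<open>0 < gap\<close> \<open>0 < m\<close> by simp
    fix \<epsilon> assume \<epsilon>: "0 < \<epsilon> \<and> \<epsilon> \<le> gap / (2 * m)"
    assume "\<exists>K L. \<forall>I :: nat cbp_instance. valid_instance I \<longrightarrow>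
      (\<exists>P. approx_packing \<alpha> (1 + \<epsilon>) K L I P)"
    then obtain K L where ex: "\<And>I :: nat cbp_instance. valid_instance I \<Longrightarrow>
      \<exists>P. approx_packing \<alpha> (1 + \<epsilon>) K L I P" by blast
    define R where "R = K + \<bar>L\<bar> * (\<Sum>c = 1..m. real (d c))"
    \<comment> \<open>\<open>N\<close> is chosen after \<open>K\<close> and \<open>L\<close>, so
      linear growth beats the constant \<open>R\<close>.\<close>
    obtain N :: nat where N: "R < N * (gap / 2)"
      using \<open>0 < gap\<close> reals_Archimedean3[of "gap / 2"] by auto
    have "0 < (\<Prod>c = 1..m. d c)" using d_pos by (simp add: prod_pos)
    \<comment> \<open>The product provides divisibility by every \<open>d c\<close> and keeps
      \<open>n\<close> at least \<open>N\<close>.\<close>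
    define n where "n = N * (\<Prod>c = 1..m. d c)"
    have "N \<le> n" unfolding n_def using \<open>0 < (\<Prod>c = 1..m. d c)\<close> by (cases "\<Prod>c = 1..m. d c") auto
    have "d c dvd n" if "c \<in> {1..m}" for c
      unfolding n_def using that by (intro dvd_mult dvd_prodI) auto
    then interpret layered m n d s
      using \<open>0 < m\<close> d_pos s s_sum by unfold_locales auto
    obtain P where "approx_packing \<alpha> (1 + \<epsilon>) K L inst P" using ex valid_inst by blast
    then have "n * (gap - m * \<epsilon>) \<le> R"
      unfolding gap_def R_def using assms(1) \<epsilon> by (intro approx_packing_bound) auto
    moreover have "N * (gap / 2) \<le> n * (gap - m * \<epsilon>)"
      using \<epsilon> \<open>N \<le> n\<close> \<open>0 < gap\<close> \<open>0 < m\<close> by (intro mult_mono) (auto simp: field_simps)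
    ultimately show False using N by linarith
  qed
qed

theorem theorem2:
  fixes \<alpha> :: real
  assumes "\<alpha> < 1.69103"
  shows "\<exists>\<epsilon>\<^sub>0>0. \<forall>\<epsilon>. 0 < \<epsilon> \<and> \<epsilon> \<le> \<epsilon>\<^sub>0 \<longrightarrow>
    \<not> (\<exists>K L. \<forall>I :: nat cbp_instance. valid_instance I \<longrightarrow>
          (\<exists>P. approx_packing \<alpha> (1 + \<epsilon>) K L I P))"
proof -
  \<comment> \<open>Colours count from 1, list positions from 0.\<close>
  define d :: "nat \<Rightarrow> nat" where "d c = [1, 2, 6, 42, 1806, 3263442] ! (c - 1)" for c
  \<comment> \<open>The six reciprocals \<open>1 / (d c + 1)\<close> fall short of 1 by about 9.4 / 10^14.\<close>
  define s where "s c = 1 / (real (d c) + 1) + 1 / 10 ^ 14" for c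
  have range: "{1..6} = {1, 2, 3, 4, 5, 6 :: nat}" by auto
  have "\<exists>\<epsilon>\<^sub>0>0. \<forall>\<epsilon>. 0 < \<epsilon> \<and> \<epsilon> \<le> \<epsilon>\<^sub>0 \<longrightarrow>
    \<not> (\<exists>K L. \<forall>I :: nat cbp_instance. valid_instance I \<longrightarrow>
          (\<exists>P. approx_packing (max \<alpha> 0) (1 + \<epsilon>) K L I P))"
  proof (rule no_approx_packing[where m = 6 and d = d and s = s])
    \<comment> \<open>The sum is about 1.6910302.\<close>
    show "max \<alpha> 0 < (\<Sum>c = 1..6. 1 / real (d c))"
      using assms unfolding range by (simp add: d_def)
    show "0 < d c" if "c \<in> {1..6}" for c
      using that unfolding range by (auto simp: d_def)
    show "1 / (real (d c) + 1) < s c \<and> s c \<le> 1 / real (d c)" if "c \<in> {1..6}" for c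
      using that unfolding range by (auto simp: d_def s_def)
    \<comment> \<open>The six increments add up to 6 / 10^14, below the shortfall.\<close>
    show "(\<Sum>c = 1..6. s c) \<le> 1" unfolding range by (simp add: d_def s_def)
  qed simp
  then show ?thesis
    by (meson approx_packing_mono max.cobounded1)
qed

end
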